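(* Let $x_1,\ldots,x_n\in\mathbb{R}$ (test nodes) and $y_1,\ldots,y_m\in\mathbb{R}$ (support nodes) be given, with $n\ge m-1$. Let $L\in\mathbb{C}^{n\times m}$ be the Loewner matrix with entries $L_{kj}=\dfrac{\mathrm{e}^{\mathrm{i}x_k}-\mathrm{e}^{\mathrm{i}y_j}}{x_k-y_j}$, and let $\sigma_1\ge\cdots\ge\sigma_m\ge 0$ be its singular values. Assume the smallest singular value is non-degenerate, i.e. $\sigma_{m-1}>\sigma_m$. Let $w=(w_1,\ldots,w_m)^\top\in\mathbb{C}^m$ with $\|w\|_2=1$ minimize the linearized error, i.e. $$\|Lw\|_2=\min_{u\in\mathbb{C}^m,\ \|u\|_2=1}\|Lu\|_2,$$ and let $$r(x)=\frac{n(x)}{d(x)},\qquad n(x)=\sum_{j=1}^m\frac{\mathrm{e}^{\mathrm{i}y_j}w_j}{x-y_j},\qquad d(x)=\sum_{j=1}^m\frac{w_j}{x-y_j},$$ be the barycentric rational approximant with coefficients $w_1,\ldots,w_m$. Assume $r$ is irreducible. Then $r$ has no poles on the real axis and satisfies $|r(x)|=1$ for all $x\in\mathbb{R}$.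
   Context: The test nodes $x_1,\ldots,x_n$ and the support nodes $y_1,\ldots,y_m$ are disjoint sets of distinct nodes. The singular values $\sigma_1\ge\cdots\ge\sigma_m\ge0$ of the $n\times m$ matrix $L$ are the $m$ square roots of the eigenvalues of $L^*L$, counted with multiplicity (so for $n=m-1$ one has $\sigma_m=0$). The linearized error is $$\|Lw\|_2=\Big(\sum_{k=1}^n|\mathrm{e}^{\mathrm{i}x_k}d(x_k)-n(x_k)|^2\Big)^{1/2}.$$ Multiplying numerator and denominator by $\prod_{j=1}^m(x-y_j)$, $r$ is identified with the rational function $r=p/q$, where $$p(x)=\sum_{j=1}^m \mathrm{e}^{\mathrm{i}y_j}w_j\prod_{k\ne j}(x-y_k),\qquad q(x)=\sum_{j=1}^m w_j\prod_{k\neq j}(x-y_k)$$ are polynomials of degree $\le m-1$; values at the support nodes are understood via $p/q$ (removable singularities). The function $r$ is called irreducible if $p$ and $q$ have no common (complex) zeros, and the poles of $r$ are the zeros of $q$. (The symbol $n$ with an argument, $n(x)$, denotes the numerator function, while $n$ without argument is the number of test nodes.) *)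

theory Defs
  imports
    "Jordan_Normal_Form.Schur_Decomposition"
    "HOL-Computational_Algebra.Fundamental_Theorem_Algebra"
    "HOL-Analysis.L2_Norm"
begin

(* Nodes and matrix/vector entries are indexed from 0: the nodes are x 0, ..., x (n - 1) and
   y 0, ..., y (m - 1). *)

definition vec_norm2 :: "complex vec \<Rightarrow> real" where
  "vec_norm2 v = L2_set (\<lambda>i. cmod (v $ i)) {..<dim_vec v}"

(* proots lists the eigenvalues of A* A with algebraic multiplicity. They are real and
   nonnegative (lemma eigenvalue_gram), so taking Re loses nothing. *)
definition singular_values :: "complex mat \<Rightarrow> real list" where
  "singular_values A =
     rev (sorted_list_of_multiset
       (image_mset (\<lambda>e. sqrt (Re e)) (proots (char_poly (mat_adjoint A * A)))))"

(* Indexed from 1: singular_value A 1 is the largest and singular_value A (dim_col A) the smallest. *)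
definition singular_value :: "complex mat \<Rightarrow> nat \<Rightarrow> real" where
  "singular_value A k = singular_values A ! (k - 1)"

definition loewner :: "nat \<Rightarrow> nat \<Rightarrow> (nat \<Rightarrow> real) \<Rightarrow> (nat \<Rightarrow> real) \<Rightarrow> complex mat" where
  "loewner n m x y = mat n m (\<lambda>(k, j).
     (exp (\<i> * complex_of_real (x k)) - exp (\<i> * complex_of_real (y j)))
       / complex_of_real (x k - y j))"

definition bary_num :: "nat \<Rightarrow> (nat \<Rightarrow> real) \<Rightarrow> complex vec \<Rightarrow> complex \<Rightarrow> complex" where
  "bary_num m y w z =
     (\<Sum>j<m. exp (\<i> * complex_of_real (y j)) * w $ j / (z - complex_of_real (y j)))"

definition bary_den :: "nat \<Rightarrow> (nat \<Rightarrow> real) \<Rightarrow> complex vec \<Rightarrow> complex \<Rightarrow> complex" where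
  "bary_den m y w z = (\<Sum>j<m. w $ j / (z - complex_of_real (y j)))"

definition bary_p :: "nat \<Rightarrow> (nat \<Rightarrow> real) \<Rightarrow> complex vec \<Rightarrow> complex poly" where
  "bary_p m y w =
     (\<Sum>j<m. Polynomial.smult (exp (\<i> * complex_of_real (y j)) * w $ j)
        (\<Prod>k\<in>{..<m} - {j}. [:- complex_of_real (y k), 1:]))"

definition bary_q :: "nat \<Rightarrow> (nat \<Rightarrow> real) \<Rightarrow> complex vec \<Rightarrow> complex poly" where
  "bary_q m y w =
     (\<Sum>j<m. Polynomial.smult (w $ j)
        (\<Prod>k\<in>{..<m} - {j}. [:- complex_of_real (y k), 1:]))"

(* The barycentric quotient n(z) / d(z), with its removable singularities at the support nodes
   filled in; see bary_approx_eq. *)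
definition bary_approx :: "nat \<Rightarrow> (nat \<Rightarrow> real) \<Rightarrow> complex vec \<Rightarrow> complex \<Rightarrow> complex" where
  "bary_approx m y w z = poly (bary_p m y w) z / poly (bary_q m y w) z"

definition bary_irreducible :: "nat \<Rightarrow> (nat \<Rightarrow> real) \<Rightarrow> complex vec \<Rightarrow> bool" where
  "bary_irreducible m y w \<longleftrightarrow>
     \<not> (\<exists>z. poly (bary_p m y w) z = 0 \<and> poly (bary_q m y w) z = 0)"

definition bary_poles :: "nat \<Rightarrow> (nat \<Rightarrow> real) \<Rightarrow> complex vec \<Rightarrow> complex set" where
  "bary_poles m y w = {z. poly (bary_q m y w) z = 0}"

lemma mat_adjoint_carrier:
  "A \<in> carrier_mat n m \<Longrightarrow> mat_adjoint A \<in> carrier_mat m n"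
  by (auto simp: mat_adjoint_def mat_of_rows_def)

lemma length_singular_values: "length (singular_values A) = dim_col A"
proof -
  have "mat_adjoint A * A \<in> carrier_mat (dim_col A) (dim_col A)"
    using mat_adjoint_carrier[of A "dim_row A" "dim_col A"] by auto
  then have "degree (char_poly (mat_adjoint A * A)) = dim_col A"
    using degree_monic_char_poly by blast
  then show ?thesis
    by (metis length_rev mset_sorted_list_of_multiset singular_values_def size_image_mset
        size_mset size_proots_complex)
qed

lemma eigenvalue_gram:
  fixes A :: "complex mat"
  assumes "eigenvalue (mat_adjoint A * A) e"
  shows "e \<in> \<real>" "Re e \<ge> 0"
proof -
  let ?n = "dim_row A" and ?m = "dim_col A"
  have A: "A \<in> carrier_mat ?n ?m" by simp
  have A': "mat_adjoint A \<in> carrier_mat ?m ?n"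
    using mat_adjoint_carrier[OF A] .
  have dims: "dim_row (mat_adjoint A) = ?m" "dim_col (mat_adjoint A) = ?n"
    using A' by auto
  from assms obtain v where v: "v \<in> carrier_vec ?m" "v \<noteq> 0\<^sub>v ?m"
    and ev: "(mat_adjoint A * A) *\<^sub>v v = e \<cdot>\<^sub>v v"
    unfolding eigenvalue_def eigenvector_def index_mult_mat dims by blast
  have norm_sq: "u \<bullet>c u = complex_of_real (\<Sum>i<k. (cmod (u $ i))\<^sup>2)"
    if "u \<in> carrier_vec k" for u k
    unfolding of_real_sum complex_norm_square using that
    by (simp add: scalar_prod_def lessThan_atLeast0)
  have v2: "v \<bullet>c v = complex_of_real (\<Sum>i<?m. (cmod (v $ i))\<^sup>2)"
    by (rule norm_sq) fact
  have "v \<bullet>c v \<noteq> 0" using v by simp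
  then have s: "(\<Sum>i<?m. (cmod (v $ i))\<^sup>2) > 0"
    unfolding v2 by (metis of_real_0 less_eq_real_def sum_nonneg zero_le_power2)
  define u where "u = A *\<^sub>v v"
  have u: "u \<in> carrier_vec ?n" unfolding u_def by (rule mult_mat_vec_carrier[OF A v(1)])
  have u2: "u \<bullet>c u = complex_of_real (\<Sum>i<?n. (cmod (u $ i))\<^sup>2)"
    by (rule norm_sq) fact
  have w: "mat_adjoint A *\<^sub>v u = e \<cdot>\<^sub>v v"
    using ev assoc_mult_mat_vec[OF A' A v(1)] by (simp add: u_def)
  have wi: "(mat_adjoint A *\<^sub>v u) $ i = (\<Sum>k<?n. cnj (A $$ (k, i)) * u $ k)" if "i < ?m" for i
    using that u A' by (simp add: mat_adjoint_def mat_of_rows_def scalar_prod_def lessThan_atLeast0)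
  have ui: "u $ k = (\<Sum>i<?m. A $$ (k, i) * v $ i)" if "k < ?n" for k
    using that v by (simp add: u_def scalar_prod_def lessThan_atLeast0)
  have "e * (v \<bullet>c v) = (\<Sum>i<?m. (e \<cdot>\<^sub>v v) $ i * cnj (v $ i))"
    using v by (simp add: scalar_prod_def lessThan_atLeast0 sum_distrib_left mult.assoc)
  also have "\<dots> = (\<Sum>i<?m. (\<Sum>k<?n. cnj (A $$ (k, i)) * u $ k) * cnj (v $ i))"
    by (intro sum.cong refl) (simp add: wi flip: w)
  also have "\<dots> = (\<Sum>k<?n. u $ k * (\<Sum>i<?m. cnj (A $$ (k, i) * v $ i)))"
    unfolding sum_distrib_left sum_distrib_right
    by (subst sum.swap) (simp add: mult_ac)
  also have "\<dots> = (\<Sum>k<?n. u $ k * cnj (u $ k))"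
    by (intro sum.cong refl) (simp add: ui)
  also have "\<dots> = u \<bullet>c u"
    using u by (simp add: scalar_prod_def lessThan_atLeast0)
  finally have e: "e = complex_of_real ((\<Sum>i<?n. (cmod (u $ i))\<^sup>2) / (\<Sum>i<?m. (cmod (v $ i))\<^sup>2))"
    using s unfolding u2 v2 of_real_divide
    by (metis less_irrefl nonzero_eq_divide_eq of_real_eq_0_iff)
  show "e \<in> \<real>" unfolding e by (rule Reals_of_real)
  show "Re e \<ge> 0" unfolding e Re_complex_of_real
    by (intro divide_nonneg_nonneg sum_nonneg zero_le_power2)
qed

lemma bary_approx_eq:
  assumes "z \<notin> (\<lambda>j. complex_of_real (y j)) ` {..<m}"
  shows "bary_approx m y w z = bary_num m y w z / bary_den m y w z"
proof -
  let ?l = "\<Prod>k<m. z - complex_of_real (y k)"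
  have ne: "z - complex_of_real (y k) \<noteq> 0" if "k < m" for k
    using assms that by auto
  have l: "?l \<noteq> 0" using ne by simp
  have rem: "?l / (z - complex_of_real (y j)) = (\<Prod>k\<in>{..<m} - {j}. z - complex_of_real (y k))"
    if "j < m" for j
    using that ne[OF that] by (subst prod.remove[of _ j]) auto
  have "poly (bary_p m y w) z = ?l * bary_num m y w z"
    unfolding bary_p_def bary_num_def poly_sum sum_distrib_left
    by (intro sum.cong refl) (simp add: poly_prod flip: rem)
  moreover have "poly (bary_q m y w) z = ?l * bary_den m y w z"
    unfolding bary_q_def bary_den_def poly_sum sum_distrib_left
    by (intro sum.cong refl) (simp add: poly_prod flip: rem)
  ultimately show ?thesis
    using l by (simp add: bary_approx_def)
qed

lemma linearized_error:
  assumes "w \<in> carrier_vec m"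
  shows "vec_norm2 (loewner n m x y *\<^sub>v w) =
    L2_set (\<lambda>k. cmod (exp (\<i> * complex_of_real (x k)) * bary_den m y w (complex_of_real (x k))
                       - bary_num m y w (complex_of_real (x k)))) {..<n}"
proof -
  have "(loewner n m x y *\<^sub>v w) $ k =
      exp (\<i> * complex_of_real (x k)) * bary_den m y w (complex_of_real (x k))
        - bary_num m y w (complex_of_real (x k))" if "k < n" for k
  proof -
    have "(loewner n m x y *\<^sub>v w) $ k =
        (\<Sum>j<m. (exp (\<i> * complex_of_real (x k)) - exp (\<i> * complex_of_real (y j)))
            / complex_of_real (x k - y j) * w $ j)"
      using that assms by (simp add: loewner_def scalar_prod_def lessThan_atLeast0)
    also have "\<dots> = (\<Sum>j<m. exp (\<i> * complex_of_real (x k))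
              * (w $ j / (complex_of_real (x k) - complex_of_real (y j)))
          - exp (\<i> * complex_of_real (y j)) * w $ j
              / (complex_of_real (x k) - complex_of_real (y j)))"
      by (intro sum.cong refl) (simp add: diff_divide_distrib left_diff_distrib)
    finally show ?thesis
      by (simp add: bary_num_def bary_den_def sum_subtractf sum_distrib_left)
  qed
  moreover have "dim_vec (loewner n m x y *\<^sub>v w) = n" by (simp add: loewner_def)
  ultimately show ?thesis
    unfolding vec_norm2_def by (intro L2_set_cong) auto
qed

end

theory Submission
  imports Defs
begin

text \<open>The Loewner matrix satisfies \<open>L\<^sub>k\<^sub>j e\<^bsup>-iy\<^sub>j\<^esup> = - e\<^bsup>ix\<^sub>k\<^esup> cnj L\<^sub>k\<^sub>j\<close>. Hence the map
  \<open>w\<^sub>j \<mapsto> e\<^bsup>-iy\<^sub>j\<^esup> cnj w\<^sub>j\<close> preserves the linearized error. A minimizer is an eigenvector of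
  \<open>L* L\<close> for its smallest eigenvalue, which is simple by nondegeneracy, so
  \<open>e\<^bsup>-iy\<^sub>j\<^esup> cnj w\<^sub>j = c w\<^sub>j\<close> with \<open>|c| = 1\<close>. This gives \<open>cnj q(t) = c p(t)\<close> for real \<open>t\<close>, and a
  real zero of \<open>q\<close> would be a common zero of \<open>p\<close> and \<open>q\<close>.\<close>

section \<open>Euclidean norm, inner product and the Gram matrix\<close>

lemma vec_norm2_nonneg: "vec_norm2 v \<ge> 0"
  by (simp add: vec_norm2_def)

lemma vec_norm2_square: "complex_of_real ((vec_norm2 v)\<^sup>2) = v \<bullet>c v"
  by (simp add: vec_norm2_def L2_set_def sum_nonneg scalar_prod_def lessThan_atLeast0
      flip: complex_norm_square of_real_power)

lemma vec_norm2_smult: "vec_norm2 (c \<cdot>\<^sub>v v) = cmod c * vec_norm2 v"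
proof -
  have "vec_norm2 (c \<cdot>\<^sub>v v) = L2_set (\<lambda>i. cmod c * cmod (v $ i)) {..<dim_vec v}"
    unfolding vec_norm2_def by (intro L2_set_cong) (auto simp: norm_mult)
  then show ?thesis
    by (simp add: vec_norm2_def L2_set_right_distrib)
qed

lemma vec_norm2_eq_0_iff:
  assumes "v \<in> carrier_vec n"
  shows "vec_norm2 v = 0 \<longleftrightarrow> v = 0\<^sub>v n"
  by (simp flip: conjugate_square_eq_0_vec[OF assms] vec_norm2_square)

text \<open>Serves the first-variation argument for minimizers; a real step \<open>t\<close> is
  enough there, so only the real part of the inner product enters.\<close>

lemma vec_norm2_square_diff:
  assumes u: "u \<in> carrier_vec n" and v: "v \<in> carrier_vec n"
  shows "(vec_norm2 (u - complex_of_real t \<cdot>\<^sub>v v))\<^sup>2 =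
    (vec_norm2 u)\<^sup>2 - 2 * t * Re (u \<bullet>c v) + t\<^sup>2 * (vec_norm2 v)\<^sup>2"
proof -
  have sq: "(vec_norm2 z)\<^sup>2 = (\<Sum>i<dim_vec z. (cmod (z $ i))\<^sup>2)" for z
    by (simp add: vec_norm2_def L2_set_def sum_nonneg)
  have "(cmod (a - complex_of_real t * b))\<^sup>2 =
      (cmod a)\<^sup>2 - 2 * t * Re (a * cnj b) + t\<^sup>2 * (cmod b)\<^sup>2" for a b
    by (simp add: cmod_power2) (simp add: power2_eq_square algebra_simps)
  then show ?thesis
    using u v unfolding sq
    by (simp add: scalar_prod_def lessThan_atLeast0 sum.distrib sum_subtractf sum_distrib_left distrib_left)
qed

lemma gram_inner:
  fixes A :: "complex mat"
  assumes A: "A \<in> carrier_mat n m" and u: "u \<in> carrier_vec m" and v: "v \<in> carrier_vec m"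
  shows "((mat_adjoint A * A) *\<^sub>v u) \<bullet>c v = (A *\<^sub>v u) \<bullet>c (A *\<^sub>v v)"
proof -
  have A': "mat_adjoint A \<in> carrier_mat m n"
    by (rule mat_adjoint_carrier[OF A])
  define a where "a = A *\<^sub>v u"
  have a: "a \<in> carrier_vec n"
    unfolding a_def by (rule mult_mat_vec_carrier[OF A u])
  have adj: "(mat_adjoint A *\<^sub>v a) $ i = (\<Sum>k<n. cnj (A $$ (k, i)) * a $ k)" if "i < m" for i
    using that a A A' by (simp add: mat_adjoint_def mat_of_rows_def scalar_prod_def lessThan_atLeast0)
  have Av: "(A *\<^sub>v v) $ k = (\<Sum>i<m. A $$ (k, i) * v $ i)" if "k < n" for k
    using that v A by (simp add: scalar_prod_def lessThan_atLeast0)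
  have "(mat_adjoint A * A) *\<^sub>v u = mat_adjoint A *\<^sub>v a"
    unfolding a_def by (rule assoc_mult_mat_vec[OF A' A u])
  then have "((mat_adjoint A * A) *\<^sub>v u) \<bullet>c v
      = (\<Sum>i<m. (mat_adjoint A *\<^sub>v a) $ i * cnj (v $ i))"
    using v by (simp add: scalar_prod_def lessThan_atLeast0)
  also have "\<dots> = (\<Sum>i<m. (\<Sum>k<n. cnj (A $$ (k, i)) * a $ k) * cnj (v $ i))"
    by (intro sum.cong refl) (simp add: adj)
  also have "\<dots> = (\<Sum>k<n. a $ k * (\<Sum>i<m. cnj (A $$ (k, i) * v $ i)))"
    unfolding sum_distrib_left sum_distrib_right
    by (subst sum.swap) (simp add: mult_ac)
  also have "\<dots> = (\<Sum>k<n. a $ k * cnj ((A *\<^sub>v v) $ k))"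
    by (intro sum.cong refl) (simp add: Av)
  also have "\<dots> = a \<bullet>c (A *\<^sub>v v)"
    using A by (simp add: scalar_prod_def lessThan_atLeast0)
  finally show ?thesis
    unfolding a_def .
qed

section \<open>Minimizers as eigenvectors of the Gram matrix\<close>

lemma quadratic_nonneg_imp_linear_nonpos:
  fixes h k :: real
  assumes "\<And>t. 0 \<le> t\<^sup>2 * k - 2 * t * h"
  shows "h \<le> 0"
proof (rule ccontr)
  assume h: "\<not> h \<le> 0"
  \<comment> \<open>A step this small lets the linear term win: \<open>t * k\<close> is at most
    \<open>h\<close>, hence below \<open>2 * h\<close>. The added 1 keeps the denominator positive
    when \<open>k = 0\<close>.\<close>
  define t where "t = h / (\<bar>k\<bar> + 1)"
  have t: "t > 0" and th: "t * (\<bar>k\<bar> + 1) = h"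
    using h by (auto simp: t_def)
  have "t * k \<le> t * (\<bar>k\<bar> + 1)"
    using t by (intro mult_left_mono) auto
  then have "t * (t * k - 2 * h) < 0"
    using t h th by (intro mult_pos_neg) auto
  then show False
    using assms[of t] by (simp add: power2_eq_square algebra_simps)
qed

text \<open>First variation: the form |Au|^2 - \<mu> |u|^2 is nonnegative and vanishes at
  \<open>w\<close>. Moving from \<open>w\<close> against the residual \<open>h\<close> changes it to
  first order by -2t |h|^2, so \<open>h\<close> must be zero.\<close>

lemma gram_minimizer_eigenvector:
  assumes A: "A \<in> carrier_mat n m" and w: "w \<in> carrier_vec m"
    and ge: "\<And>u. u \<in> carrier_vec m \<Longrightarrow> \<mu> * (vec_norm2 u)\<^sup>2 \<le> (vec_norm2 (A *\<^sub>v u))\<^sup>2"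
    and eq: "(vec_norm2 (A *\<^sub>v w))\<^sup>2 = \<mu> * (vec_norm2 w)\<^sup>2"
  shows "(mat_adjoint A * A) *\<^sub>v w = complex_of_real \<mu> \<cdot>\<^sub>v w"
proof -
  let ?G = "mat_adjoint A * A"
  define h where "h = ?G *\<^sub>v w - complex_of_real \<mu> \<cdot>\<^sub>v w"
  have G: "?G \<in> carrier_mat m m"
    using mat_adjoint_carrier[OF A] A by simp
  have Gw: "?G *\<^sub>v w \<in> carrier_vec m"
    by (rule mult_mat_vec_carrier[OF G w])
  have h: "h \<in> carrier_vec m"
    using Gw w by (simp add: h_def)
  have Aw: "A *\<^sub>v w \<in> carrier_vec n" and Ah: "A *\<^sub>v h \<in> carrier_vec n"
    using mult_mat_vec_carrier[OF A] w h by auto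
  have "h \<bullet>c h = (A *\<^sub>v w) \<bullet>c (A *\<^sub>v h) - complex_of_real \<mu> * (w \<bullet>c h)"
    unfolding gram_inner[OF A w h, symmetric]
    using Gw w h by (subst (1) h_def) (simp add: minus_scalar_prod_distrib[where n = m])
  then have hh: "(vec_norm2 h)\<^sup>2 = Re ((A *\<^sub>v w) \<bullet>c (A *\<^sub>v h)) - \<mu> * Re (w \<bullet>c h)"
    unfolding vec_norm2_square[symmetric] by (simp add: complex_eq_iff)
  \<comment> \<open>The right-hand side is the form evaluated at w - t h: the constant term cancels
    by \<open>eq\<close>, and \<open>hh\<close> identifies the linear coefficient.\<close>
  have "0 \<le> t\<^sup>2 * ((vec_norm2 (A *\<^sub>v h))\<^sup>2 - \<mu> * (vec_norm2 h)\<^sup>2) - 2 * t * (vec_norm2 h)\<^sup>2" for t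
  proof -
    have "A *\<^sub>v (w - complex_of_real t \<cdot>\<^sub>v h) = A *\<^sub>v w - complex_of_real t \<cdot>\<^sub>v (A *\<^sub>v h)"
      using A w h by (simp add: mult_minus_distrib_mat_vec mult_mat_vec)
    then show ?thesis
      using ge[of "w - complex_of_real t \<cdot>\<^sub>v h"] w h
      by (simp add: vec_norm2_square_diff[OF w h] vec_norm2_square_diff[OF Aw Ah] eq hh algebra_simps)
  qed
  then have "(vec_norm2 h)\<^sup>2 \<le> 0"
    by (rule quadratic_nonneg_imp_linear_nonpos)
  then have "h = 0\<^sub>v m"
    using vec_norm2_eq_0_iff[OF h] by simp
  then have "(?G *\<^sub>v w) $ i = (complex_of_real \<mu> \<cdot>\<^sub>v w) $ i" if "i < m" for i
    using that w Gw unfolding h_def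
    by (metis carrier_vecD eq_iff_diff_eq_0 index_minus_vec(1) index_smult_vec(2) index_zero_vec(1))
  then show ?thesis
    using carrier_vecD[OF Gw] carrier_vecD[OF w] by (intro eq_vecI) (simp_all del: dim_mult_mat_vec)
qed

section \<open>Simple eigenvalues have one-dimensional eigenspaces\<close>

text \<open>Back substitution from the last row upwards: in row \<open>i\<close> the entries left of
  the diagonal vanish, and the coordinates of \<open>v\<close> to the right vanish by induction.
  What remains is B_ii v_i = e v_i with B_ii different from \<open>e\<close>.\<close>

lemma upper_triangular_eigenvector:
  fixes B :: "'a :: field mat"
  assumes B: "B \<in> carrier_mat n n" "upper_triangular B"
    and diag: "\<And>i. 0 < i \<Longrightarrow> i < n \<Longrightarrow> B $$ (i, i) \<noteq> e"
    and v: "v \<in> carrier_vec n" "B *\<^sub>v v = e \<cdot>\<^sub>v v"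
  shows "0 < i \<Longrightarrow> i < n \<Longrightarrow> v $ i = 0"
proof (induction "n - i" arbitrary: i rule: less_induct)
  case less
  have "e * v $ i = (B *\<^sub>v v) $ i"
    using v less.prems by simp
  also have "\<dots> = (\<Sum>j<n. B $$ (i, j) * v $ j)"
    using B(1) v(1) less.prems by (simp add: scalar_prod_def lessThan_atLeast0)
  also have "\<dots> = (\<Sum>j\<in>{i}. B $$ (i, j) * v $ j)"
  proof (intro sum.mono_neutral_right ballI)
    fix j assume j: "j \<in> {..<n} - {i}"
    show "B $$ (i, j) * v $ j = 0"
    proof (cases "j < i")
      case True
      then show ?thesis
        using B less.prems by auto
    next
      case False
      then have "i < j" and "j < n"
        using j by auto
      then show ?thesis
        using less.prems less.hyps[of j] by simp
    qed
  qed (use less.prems in auto)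
  finally show ?case
    using diag[OF less.prems] by auto
qed

text \<open>A Schur form A = P B Q with \<open>e\<close> in the top left corner has \<open>e\<close>
  nowhere else on its diagonal. Then \<open>Q\<close> sends every eigenvector for \<open>e\<close>
  to a multiple of the first unit vector.\<close>

lemma simple_eigenvalue_unique_eigenvector:
  fixes A :: "complex mat"
  assumes A: "A \<in> carrier_mat n n" and simple: "order e (char_poly A) \<le> 1"
    and v: "v \<in> carrier_vec n" "v \<noteq> 0\<^sub>v n" "A *\<^sub>v v = e \<cdot>\<^sub>v v"
    and u: "u \<in> carrier_vec n" "A *\<^sub>v u = e \<cdot>\<^sub>v u"
  shows "\<exists>c. u = c \<cdot>\<^sub>v v"
proof -
  have p0: "char_poly A \<noteq> 0" and monic: "lead_coeff (char_poly A) = 1"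
    using degree_monic_char_poly[OF A] by auto
  have "eigenvalue A e"
    using A v unfolding eigenvalue_def eigenvector_def by auto
  then have "e \<in># proots (char_poly A)"
    using p0 by (simp add: eigenvalue_root_char_poly[OF A])
  \<comment> \<open>One copy of \<open>e\<close> is split off so that it can head the eigenvalue
    list passed to \<open>schur_decomposition\<close>.\<close>
  then obtain M where M: "proots (char_poly A) = add_mset e M"
    by (metis insert_DiffM)
  obtain es where es: "mset es = M"
    using ex_mset by blast
  have "count (proots (char_poly A)) e \<le> 1"
    using simple p0 by simp
  then have e: "e \<notin> set es"
    unfolding M es[symmetric] by (simp add: count_eq_zero_iff)
  have "char_poly A = (\<Prod>a\<in>#proots (char_poly A). [:- a, 1:])"
    using complex_poly_decompose_multiset[of "char_poly A"] monic by simp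
  also have "\<dots> = (\<Prod>a\<leftarrow>e # es. [:- a, 1:])"
    unfolding M es[symmetric] by (simp flip: prod_mset_prod_list mset_map)
  finally have split: "char_poly A = (\<Prod>a\<leftarrow>e # es. [:- a, 1:])" .
  obtain B P Q where BPQ: "schur_decomposition A (e # es) = (B, P, Q)"
    by (cases "schur_decomposition A (e # es)")
  have wit: "similar_mat_wit A B P Q" and B: "upper_triangular B" "diag_mat B = e # es"
    using schur_decomposition[OF A split BPQ] by auto
  note PQ = similar_mat_witD2[OF A wit]
  have diag: "B $$ (i, i) \<noteq> e" if "0 < i" "i < n" for i
  proof -
    have "B $$ (i, i) = (e # es) ! i" and "length (e # es) = n"
      using PQ(5) that unfolding B(2)[symmetric] by (auto simp: diag_mat_def)
    then have "B $$ (i, i) \<in> set es"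
      using that by (auto simp: nth_Cons')
    then show ?thesis
      using e by auto
  qed
  \<comment> \<open>Since B Q = Q A, the vector \<open>Q *\<^sub>v z\<close> is an eigenvector of
    \<open>B\<close> or zero, and back substitution applies.\<close>
  have Qz: "(Q *\<^sub>v z) $ i = 0" if z: "z \<in> carrier_vec n" "A *\<^sub>v z = e \<cdot>\<^sub>v z" and i: "0 < i" "i < n"
    for z i
  proof (rule upper_triangular_eigenvector[OF PQ(5) B(1) diag _ _ i])
    have Qz: "Q *\<^sub>v z \<in> carrier_vec n"
      by (rule mult_mat_vec_carrier[OF PQ(7) z(1)])
    show "Q *\<^sub>v z \<in> carrier_vec n" by fact
    have BQz: "B *\<^sub>v (Q *\<^sub>v z) \<in> carrier_vec n"
      by (rule mult_mat_vec_carrier[OF PQ(5) Qz])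
    have "A *\<^sub>v z = P *\<^sub>v (B *\<^sub>v (Q *\<^sub>v z))"
      using assoc_mult_mat_vec[OF mult_carrier_mat[OF PQ(6,5)] PQ(7) z(1)]
        assoc_mult_mat_vec[OF PQ(6,5) Qz] by (simp flip: PQ(3))
    then have "Q *\<^sub>v (e \<cdot>\<^sub>v z) = B *\<^sub>v (Q *\<^sub>v z)"
      unfolding z(2)[symmetric] using assoc_mult_mat_vec[OF PQ(7,6) BQz] PQ(2) BQz by simp
    then show "B *\<^sub>v (Q *\<^sub>v z) = e \<cdot>\<^sub>v (Q *\<^sub>v z)"
      using mult_mat_vec[OF PQ(7) z(1)] by simp
  qed
  have PQz: "P *\<^sub>v (Q *\<^sub>v z) = z" if "z \<in> carrier_vec n" for z
    using assoc_mult_mat_vec[OF PQ(6,7) that] PQ(1) that by simp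
  have Qv: "Q *\<^sub>v v \<in> carrier_vec n" and Qu: "Q *\<^sub>v u \<in> carrier_vec n"
    using mult_mat_vec_carrier[OF PQ(7)] u v by auto
  have a0: "(Q *\<^sub>v v) $ 0 \<noteq> 0"
  proof
    assume "(Q *\<^sub>v v) $ 0 = 0"
    then have "(Q *\<^sub>v v) $ i = 0" if "i < n" for i
      using Qz[OF v(1,3)] that by (cases "i = 0") auto
    then have "Q *\<^sub>v v = 0\<^sub>v n"
      using carrier_vecD[OF Qv] by (intro eq_vecI) (simp_all del: dim_mult_mat_vec)
    then have "v = P *\<^sub>v 0\<^sub>v n"
      using PQz[OF v(1)] by simp
    also have "\<dots> = 0\<^sub>v n"
      using PQ(6) by (intro eq_vecI) (auto simp: scalar_prod_def)
    finally show False using v(2) by simp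
  qed
  \<comment> \<open>Only the coordinates at index 0 can be nonzero, so their ratio is the factor of
    proportionality.\<close>
  define c where "c = (Q *\<^sub>v u) $ 0 / (Q *\<^sub>v v) $ 0"
  have "(Q *\<^sub>v u) $ i = (c \<cdot>\<^sub>v (Q *\<^sub>v v)) $ i" if "i < n" for i
    using Qz[OF v(1,3)] Qz[OF u] a0 that carrier_vecD[OF Qv]
    by (cases "i = 0") (simp_all add: c_def del: dim_mult_mat_vec)
  then have "Q *\<^sub>v u = c \<cdot>\<^sub>v (Q *\<^sub>v v)"
    using carrier_vecD[OF Qv] carrier_vecD[OF Qu]
    by (intro eq_vecI) (simp_all del: dim_mult_mat_vec)
  then have "u = c \<cdot>\<^sub>v v"
    using PQz[OF u(1)] PQz[OF v(1)] mult_mat_vec[OF PQ(6) Qv] by simp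
  then show ?thesis ..
qed

section \<open>From the singular value gap to a simple eigenvalue\<close>

text \<open>All entries after the first are strictly above the first and hence above the lower bound
  \<open>a\<close>, so \<open>a\<close> can only occur at the head of the sorted list.\<close>

lemma count_Min_le_1:
  fixes M :: "'a :: linorder multiset"
  assumes "1 < size M" and "sorted_list_of_multiset M ! 0 < sorted_list_of_multiset M ! 1"
    and "\<And>b. b \<in># M \<Longrightarrow> a \<le> b"
  shows "count M a \<le> 1"
proof -
  have "length (sorted_list_of_multiset M) = size M"
    by (metis mset_sorted_list_of_multiset size_mset)
  then obtain s t l where l: "sorted_list_of_multiset M = s # t # l"
    using assms(1) by (metis One_nat_def Suc_lessE length_Suc_conv not_less_zero less_nat_zero_code
        list.exhaust list.size(3) list.size(4) nat_neq_iff add_0 add.right_neutral add_Suc_right)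
  have "sorted (s # t # l)"
    using sorted_sorted_list_of_multiset[of M] l by simp
  moreover have M: "M = mset (s # t # l)"
    using l by (metis mset_sorted_list_of_multiset)
  moreover have "s < t"
    using assms(2) l by simp
  moreover have "a \<le> s"
    using assms(3)[of s] M by simp
  ultimately have "a \<notin> set (t # l)"
    by auto
  then have "count (mset (t # l)) a = 0"
    by (simp only: count_eq_zero_iff set_mset_mset not_False_eq_True)
  then show ?thesis
    unfolding M by simp
qed

lemma count_le_count_image_mset: "count M a \<le> count (image_mset f M) (f a)"
  by (induction M) auto

text \<open>The bound \<open>ge\<close> says that \<mu> lies below all Rayleigh quotients of the
  Gram matrix, hence below all its eigenvalues. So \<open>sqrt \<mu>\<close> is a lower bound for
  the singular values, and the gap lets it occur at most once among them.\<close>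

lemma order_min_eigenvalue_le_1:
  fixes A :: "complex mat"
  assumes A: "A \<in> carrier_mat n m"
    and nondeg: "m \<ge> 2 \<longrightarrow> singular_value A (m - 1) > singular_value A m"
    and ge: "\<And>u. u \<in> carrier_vec m \<Longrightarrow> \<mu> * (vec_norm2 u)\<^sup>2 \<le> (vec_norm2 (A *\<^sub>v u))\<^sup>2"
  shows "order (complex_of_real \<mu>) (char_poly (mat_adjoint A * A)) \<le> 1"
proof -
  let ?G = "mat_adjoint A * A" and ?f = "\<lambda>e. sqrt (Re e)"
  let ?p = "char_poly ?G"
  have G: "?G \<in> carrier_mat m m"
    using mat_adjoint_carrier[OF A] A by simp
  have deg: "degree ?p = m" and p0: "?p \<noteq> 0"
    using degree_monic_char_poly[OF G] by auto
  show ?thesis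
  proof (cases "m \<ge> 2")
    \<comment> \<open>With fewer than two columns there is no gap to use; the degree of the
      characteristic polynomial already bounds the order.\<close>
    case False
    then show ?thesis
      using order_degree[OF p0] deg by (metis le_trans not_less_eq_eq numeral_2_eq_2 One_nat_def)
  next
    case True
    define M where "M = image_mset ?f (proots ?p)"
    have size: "size M = m"
      by (simp add: M_def size_proots_complex deg)
    have len: "length (sorted_list_of_multiset M) = m"
      by (metis mset_sorted_list_of_multiset size_mset size)
    have "singular_values A = rev (sorted_list_of_multiset M)"
      by (simp add: singular_values_def M_def)
    \<comment> \<open>In the ascending list, positions 0 and 1 hold the singular values numbered
      \<open>m\<close> and \<open>m - 1\<close>.\<close>
    then have "sorted_list_of_multiset M ! 0 < sorted_list_of_multiset M ! 1"
      using nondeg True len by (auto simp: singular_value_def rev_nth numeral_2_eq_2 Suc_diff_Suc)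
    moreover have "sqrt \<mu> \<le> b" if b: "b \<in># M" for b
    proof -
      obtain e where e: "b = ?f e" "eigenvalue ?G e"
        using b p0 by (auto simp: M_def eigenvalue_root_char_poly[OF G])
      obtain v where v: "v \<in> carrier_vec m" "v \<noteq> 0\<^sub>v m" "?G *\<^sub>v v = e \<cdot>\<^sub>v v"
        using e(2) G unfolding eigenvalue_def eigenvector_def by auto
      \<comment> \<open>Pairing the eigenvector equation with \<open>v\<close> expresses
        \<open>e\<close> as a Rayleigh quotient.\<close>
      have "complex_of_real ((vec_norm2 (A *\<^sub>v v))\<^sup>2) = e * complex_of_real ((vec_norm2 v)\<^sup>2)"
        unfolding vec_norm2_square gram_inner[OF A v(1) v(1), symmetric] v(3) using v(1) by simp
      then have "(vec_norm2 (A *\<^sub>v v))\<^sup>2 = Re e * (vec_norm2 v)\<^sup>2"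
        by (simp only: complex_eq_iff) simp
      then have "\<mu> * (vec_norm2 v)\<^sup>2 \<le> Re e * (vec_norm2 v)\<^sup>2"
        using ge[OF v(1)] by simp
      moreover have "(vec_norm2 v)\<^sup>2 > 0"
        using v vec_norm2_eq_0_iff[OF v(1)] by simp
      ultimately show ?thesis
        unfolding e(1) by simp
    qed
    ultimately have "count M (sqrt \<mu>) \<le> 1"
      using size True by (intro count_Min_le_1) auto
    \<comment> \<open>Taking \<open>sqrt (Re e)\<close> may merge eigenvalues but never splits equal
      ones, so multiplicities can only grow.\<close>
    moreover have "count (proots ?p) (complex_of_real \<mu>) \<le> count M (sqrt \<mu>)"
      using count_le_count_image_mset[of "proots ?p" "complex_of_real \<mu>" ?f] by (simp add: M_def)
    ultimately show ?thesis
      using p0 by simp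
  qed
qed

section \<open>Uniqueness of the minimizer up to a phase\<close>

text \<open>Both vectors are eigenvectors for the squared minimum, a simple eigenvalue of the Gram
  matrix; equal norms force the factor to have modulus 1.\<close>

lemma minimizer_unique:
  assumes A: "A \<in> carrier_mat n m"
    and nondeg: "m \<ge> 2 \<longrightarrow> singular_value A (m - 1) > singular_value A m"
    and w: "is_arg_min (\<lambda>u. vec_norm2 (A *\<^sub>v u)) (\<lambda>u. u \<in> carrier_vec m \<and> vec_norm2 u = 1) w"
    and u: "u \<in> carrier_vec m" "vec_norm2 u = 1" "vec_norm2 (A *\<^sub>v u) = vec_norm2 (A *\<^sub>v w)"
  shows "\<exists>c. cmod c = 1 \<and> u = c \<cdot>\<^sub>v w"
proof -
  let ?G = "mat_adjoint A * A"
  have wm: "w \<in> carrier_vec m" and w1: "vec_norm2 w = 1"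
    using w by (auto simp: is_arg_min_def)
  have min: "vec_norm2 (A *\<^sub>v w) \<le> vec_norm2 (A *\<^sub>v z)" if "z \<in> carrier_vec m" "vec_norm2 z = 1" for z
    using w that by (auto simp: is_arg_min_def not_less)
  define \<mu> where "\<mu> = (vec_norm2 (A *\<^sub>v w))\<^sup>2"
  \<comment> \<open>By homogeneity the minimum over unit vectors bounds all vectors: rescale
    \<open>z\<close> to norm 1, the zero vector being trivial.\<close>
  have ge: "\<mu> * (vec_norm2 z)\<^sup>2 \<le> (vec_norm2 (A *\<^sub>v z))\<^sup>2" if z: "z \<in> carrier_vec m" for z
  proof (cases "vec_norm2 z = 0")
    case False
    then have pos: "vec_norm2 z > 0"
      using vec_norm2_nonneg[of z] by simp
    define c where "c = complex_of_real (1 / vec_norm2 z)"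
    have c: "cmod c = 1 / vec_norm2 z"
      using pos by (simp add: c_def norm_divide)
    have "vec_norm2 (A *\<^sub>v w) \<le> vec_norm2 (A *\<^sub>v (c \<cdot>\<^sub>v z))"
      using z pos by (intro min) (auto simp: vec_norm2_smult c)
    also have "\<dots> = vec_norm2 (A *\<^sub>v z) / vec_norm2 z"
      by (simp add: mult_mat_vec[OF A z] vec_norm2_smult c)
    finally have "vec_norm2 (A *\<^sub>v w) * vec_norm2 z \<le> vec_norm2 (A *\<^sub>v z)"
      using pos by (simp add: field_simps)
    then show ?thesis
      unfolding \<mu>_def power_mult_distrib[symmetric]
      by (intro power_mono) (auto simp: vec_norm2_nonneg)
  qed auto
  have G: "?G \<in> carrier_mat m m"
    using mat_adjoint_carrier[OF A] A by simp
  have "?G *\<^sub>v w = complex_of_real \<mu> \<cdot>\<^sub>v w"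
    using ge by (intro gram_minimizer_eigenvector[OF A wm]) (auto simp: w1 simp flip: \<mu>_def)
  moreover have "?G *\<^sub>v u = complex_of_real \<mu> \<cdot>\<^sub>v u"
    using ge by (intro gram_minimizer_eigenvector[OF A u(1)]) (auto simp: u simp flip: \<mu>_def)
  moreover have "order (complex_of_real \<mu>) (char_poly ?G) \<le> 1"
    using ge by (intro order_min_eigenvalue_le_1[OF A nondeg])
  moreover have "w \<noteq> 0\<^sub>v m"
    using w1 vec_norm2_eq_0_iff[OF wm] by auto
  ultimately obtain c where c: "u = c \<cdot>\<^sub>v w"
    using simple_eigenvalue_unique_eigenvector[OF G _ wm _ _ u(1)] by blast
  then have "cmod c = 1"
    using u(2) w1 by (simp add: vec_norm2_smult)
  then show ?thesis
    using c by blast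
qed

section \<open>The conjugation symmetry of the Loewner matrix\<close>

text \<open>Reflection of the approximant in the unit circle: on the real axis these coefficients
  exchange p and q up to conjugation, so r turns into 1 / cnj r.\<close>

definition conj_coeffs :: "nat \<Rightarrow> (nat \<Rightarrow> real) \<Rightarrow> complex vec \<Rightarrow> complex vec" where
  "conj_coeffs m y w = vec m (\<lambda>j. exp (- \<i> * complex_of_real (y j)) * cnj (w $ j))"

lemma conj_coeffs_carrier: "conj_coeffs m y w \<in> carrier_vec m"
  by (simp add: conj_coeffs_def)

lemma vec_norm2_conj_coeffs:
  assumes "w \<in> carrier_vec m"
  shows "vec_norm2 (conj_coeffs m y w) = vec_norm2 w"
  unfolding vec_norm2_def using assms
  by (intro L2_set_cong) (auto simp: conj_coeffs_def norm_mult)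

lemma vec_norm2_loewner_conj_coeffs:
  assumes w: "w \<in> carrier_vec m"
  shows "vec_norm2 (loewner n m x y *\<^sub>v conj_coeffs m y w) = vec_norm2 (loewner n m x y *\<^sub>v w)"
proof -
  let ?L = "loewner n m x y"
  have cnj_exp: "cnj (exp (\<i> * complex_of_real t)) = exp (- \<i> * complex_of_real t)" for t
    using cis_cnj[of t] cis_conv_exp[of t] cis_conv_exp[of "- t"] by simp
  \<comment> \<open>Both numerators equal e^(i(x_k - y_j)) - 1, and the denominator is real, so
    conjugation leaves it alone.\<close>
  have entry: "?L $$ (k, j) * exp (- \<i> * complex_of_real (y j))
      = - exp (\<i> * complex_of_real (x k)) * cnj (?L $$ (k, j))" if "k < n" "j < m" for k j
  proof -
    have "(exp (\<i> * complex_of_real (x k)) - exp (\<i> * complex_of_real (y j)))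
          * exp (- \<i> * complex_of_real (y j))
        = - exp (\<i> * complex_of_real (x k))
          * (exp (- \<i> * complex_of_real (x k)) - exp (- \<i> * complex_of_real (y j)))"
      by (simp add: algebra_simps flip: exp_add)
    then show ?thesis
      using that by (simp add: loewner_def cnj_exp)
  qed
  \<comment> \<open>Each residual is conjugated and multiplied by a number of modulus 1 that depends
    only on the row, so its modulus is unchanged.\<close>
  have "(?L *\<^sub>v conj_coeffs m y w) $ k = - exp (\<i> * complex_of_real (x k)) * cnj ((?L *\<^sub>v w) $ k)"
    if k: "k < n" for k
  proof -
    have "(?L *\<^sub>v conj_coeffs m y w) $ k
        = (\<Sum>j<m. (?L $$ (k, j) * exp (- \<i> * complex_of_real (y j))) * cnj (w $ j))"
      using k by (simp add: scalar_prod_def lessThan_atLeast0 conj_coeffs_def loewner_def mult.assoc)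
    also have "\<dots> = (\<Sum>j<m. - exp (\<i> * complex_of_real (x k)) * cnj (?L $$ (k, j) * w $ j))"
      using k by (intro sum.cong refl) (simp only: entry lessThan_iff complex_cnj_mult mult.assoc)
    also have "\<dots> = - exp (\<i> * complex_of_real (x k)) * cnj ((?L *\<^sub>v w) $ k)"
      using k w by (simp add: scalar_prod_def lessThan_atLeast0 loewner_def sum_distrib_left sum_negf)
    finally show ?thesis .
  qed
  then show ?thesis
    unfolding vec_norm2_def by (intro L2_set_cong) (auto simp: loewner_def norm_mult)
qed

text \<open>Multiplied by e^(i y_j), the hypothesis says that cnj w_j is \<open>c\<close> times the
  coefficient of p at node j; the node factors t - y_k are real and survive conjugation.\<close>

lemma cnj_bary_q:
  assumes "conj_coeffs m y w = c \<cdot>\<^sub>v w" and "w \<in> carrier_vec m"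
  shows "cnj (poly (bary_q m y w) (complex_of_real t)) = c * poly (bary_p m y w) (complex_of_real t)"
proof -
  have "cnj (w $ j) = c * (exp (\<i> * complex_of_real (y j)) * w $ j)" if "j < m" for j
  proof -
    have "exp (- \<i> * complex_of_real (y j)) * cnj (w $ j) = c * w $ j"
      using arg_cong[OF assms(1), of "\<lambda>v. v $ j"] that assms(2) by (simp add: conj_coeffs_def)
    then show ?thesis
      by (simp add: exp_minus field_simps)
  qed
  then show ?thesis
    by (simp add: bary_q_def bary_p_def poly_sum poly_prod sum_distrib_left mult.assoc)
qed

theorem proposition3:
  fixes n m :: nat and x y :: "nat \<Rightarrow> real" and w :: "complex vec"
  assumes "m \<le> n + 1"
    and "inj_on x {..<n}" and "inj_on y {..<m}" and "x ` {..<n} \<inter> y ` {..<m} = {}"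
    and "m \<ge> 2 \<longrightarrow>
      singular_value (loewner n m x y) (m - 1) > singular_value (loewner n m x y) m"
    and "is_arg_min (\<lambda>u. vec_norm2 (loewner n m x y *\<^sub>v u))
      (\<lambda>u. u \<in> carrier_vec m \<and> vec_norm2 u = 1) w"
    and "bary_irreducible m y w"
  shows "bary_poles m y w \<inter> \<real> = {} \<and>
    (\<forall>t::real. cmod (bary_approx m y w (complex_of_real t)) = 1)"
proof -
  have L: "loewner n m x y \<in> carrier_mat n m"
    by (simp add: loewner_def)
  have w: "w \<in> carrier_vec m" "vec_norm2 w = 1"
    using assms(6) by (auto simp: is_arg_min_def)
  \<comment> \<open>The reflected coefficients have the same norm and the same linearized error as
    \<open>w\<close>, so they form another minimizer.\<close>
  obtain c where c: "cmod c = 1" "conj_coeffs m y w = c \<cdot>\<^sub>v w"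
    using minimizer_unique[OF L assms(5,6) conj_coeffs_carrier[of m y w]] w
    by (auto simp: vec_norm2_conj_coeffs vec_norm2_loewner_conj_coeffs)
  have norm_eq: "cmod (poly (bary_q m y w) (complex_of_real t)) = cmod (poly (bary_p m y w) (complex_of_real t))"
    for t
    using arg_cong[OF cnj_bary_q[OF c(2) w(1)], of cmod] c(1) by (simp add: norm_mult)
  \<comment> \<open>Besides excluding real poles, this keeps \<open>bary_approx\<close> away from
    the default value 0 of division by zero, so equal moduli do give quotient modulus 1.\<close>
  moreover from this have "poly (bary_q m y w) (complex_of_real t) \<noteq> 0" for t
    using assms(7) unfolding bary_irreducible_def by (metis norm_eq_zero)
  moreover from calculation have "poly (bary_p m y w) (complex_of_real t) \<noteq> 0" for t
    by (metis norm_eq_zero)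
  ultimately show ?thesis
    by (auto simp: bary_poles_def bary_approx_def norm_divide elim!: Reals_cases)
qed

end
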